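(* Let $[n]_q=(1-q^n)/(1-q)$ and $\lambda=1-q^{-2}$. The braided-Killing form for the spin $\tfrac12$ differential calculus on $\mathbb C_q[SU_2]$, divided by $(q-1)^2$, is $$\eta=q^{-12}[8]_q[2]_q\,\eta_K-\lambda\big([3]_q(q^{-9}+q^{-7})-[2]_q^2q^{-2}\big)\,\theta\otimes\theta,$$ $$\eta_K=e_b\otimes e_c+q^2e_c\otimes e_b+\frac{e_a\otimes e_a-q\,e_a\otimes e_d-q\,e_d\otimes e_a+q(q^2+q-1)\,e_d\otimes e_d}{[2]_q},$$ where $\theta=e_a+e_d$.
   Context: $q\in\mathbb C^*$ is generic (not a root of unity). $H=\mathbb C_q[SU_2]$ is generated by $t^1{}_1=a$, $t^1{}_2=b$, $t^2{}_1=c$, $t^2{}_2=d$ with $ba=qab$, $ca=qac$, $db=qbd$, $dc=qcd$, $bc=cb$, $da-ad=(q-q^{-1})bc$, $ad-q^{-1}bc=1$, $\Delta t^i{}_j=t^i{}_k\otimes t^k{}_j$, $\epsilon(t^i{}_j)=\delta^i_j$, $Sa=d$, $Sd=a$, $Sb=-qb$, $Sc=-q^{-1}c$. It is dual-quasitriangular with $\mathcal R(t^i{}_j\otimes t^k{}_l)=R^i{}_j{}^k{}_l$, whose nonzero entries are $R^1{}_1{}^1{}_1=R^2{}_2{}^2{}_2=q^{-1/2}q$, $R^1{}_1{}^2{}_2=R^2{}_2{}^1{}_1=q^{-1/2}$, $R^1{}_2{}^2{}_1=q^{-1/2}(q-q^{-1})$, extended by $\mathcal R(xy\otimes z)=\mathcal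 R(x\otimes z_{(1)})\mathcal R(y\otimes z_{(2)})$, $\mathcal R(x\otimes yz)=\mathcal R(x_{(1)}\otimes z)\mathcal R(x_{(2)}\otimes y)$. $W=\mathbb C^2$ is the spin $\frac12$ comodule with basis $e_1,e_2$, coaction $e_\alpha\mapsto e_\beta\otimes t^\beta{}_\alpha$ (so $\rho^\alpha{}_\beta=t^\alpha{}_\beta$), and dual basis $f^1,f^2$. $V=\mathrm{End}(W)$ has basis $e_\alpha{}^\beta=e_\alpha\otimes f^\beta$, written $e_a=e_1{}^1$, $e_b=e_2{}^1$, $e_c=e_1{}^2$, $e_d=e_2{}^2$; an endomorphism with matrix $\phi^\alpha{}_\beta$ is $\phi^\alpha{}_\beta\,e_\alpha{}^\beta$, so $\theta=\mathrm{id}$. $\mathcal Q:H\to H^*$ is $\langle\mathcal Q(h),g\rangle=\mathcal R(g_{(1)}\otimes h_{(1)})\mathcal R(h_{(2)}\otimes g_{(2)})$ and $(\rho_W\circ\mathcal Q)(h)^\alpha{}_\beta=\langle\mathcal Q(h),t^\alpha{}_\beta\rangle$. The spin $\frac12$ (four-dimensional) bicovariant calculus has $\Omega_0=\ker\epsilon/\ker(\rho_W\circ\mathcal Q)\cong V$. The braided-Killing form is the element $$(\rho_W\circ\mathcal Q\otimes\rho_W\circ\mathcal Q)(\Delta T)-\mathrm{id}\otimes\rho_W\circ\mathcal Q(T)-\rho_W\circ\mathcal Q(T)\otimes\mathrm{id}+\epsilon(T)\,\mathrm{id}\otimes\mathrm{id}\in V\otimes V,$$ where $T=\mathcal R(\tau_{(1)}\otimes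 S\tau_{(2)})\tau_{(3)}$ and $\tau=\rho^\alpha{}_\alpha S\rho^\beta{}_\beta=(a+d)S(a+d)$. *)

theory Defs
  imports "HOL-Analysis.Cartesian_Space" "HOL-Library.Poly_Mapping"
begin

section \<open>Complex vector spaces and algebras\<close>

class scaleC =
  fixes scaleC :: "complex \<Rightarrow> 'a \<Rightarrow> 'a"  (infixr \<open>*\<^sub>C\<close> 75)

class complex_vector = scaleC + ab_group_add +
  assumes scaleC_add_right: "c *\<^sub>C (x + y) = c *\<^sub>C x + c *\<^sub>C y"
    and scaleC_add_left: "(c + d) *\<^sub>C x = c *\<^sub>C x + d *\<^sub>C x"
    and scaleC_scaleC: "c *\<^sub>C d *\<^sub>C x = (c * d) *\<^sub>C x"
    and scaleC_one: "1 *\<^sub>C x = x"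

class complex_algebra_1 = complex_vector + ring_1 +
  assumes mult_scaleC_left: "(c *\<^sub>C x) * y = c *\<^sub>C (x * y)"
    and mult_scaleC_right: "x * (c *\<^sub>C y) = c *\<^sub>C (x * y)"

global_interpretation complex_vector: vector_space "scaleC :: complex \<Rightarrow> 'a \<Rightarrow> 'a::complex_vector"
  by standard (auto simp: scaleC_add_right scaleC_add_left scaleC_scaleC scaleC_one)

abbreviation clinear :: "('a::complex_vector \<Rightarrow> 'b::complex_vector) \<Rightarrow> bool"
  where "clinear \<equiv> Vector_Spaces.linear scaleC scaleC"

lemma clinearI:
  assumes "\<And>x y. f (x + y) = f x + f y" "\<And>c x. f (c *\<^sub>C x) = c *\<^sub>C f x"
  shows "clinear f"
  using assms by unfold_locales

lemma clinear_add:
  assumes "clinear f"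
  shows "f (x + y) = f x + f y"
proof -
  interpret Vector_Spaces.linear scaleC scaleC f by (rule assms)
  show ?thesis by (rule add)
qed

lemma clinear_scaleC:
  assumes "clinear f"
  shows "f (c *\<^sub>C x) = c *\<^sub>C f x"
proof -
  interpret Vector_Spaces.linear scaleC scaleC f by (rule assms)
  show ?thesis by (rule scale)
qed

lemma clinear_add_fun: "clinear f \<Longrightarrow> clinear g \<Longrightarrow> clinear (\<lambda>x. f x + g x)"
  by (rule clinearI) (simp_all add: clinear_add clinear_scaleC scaleC_add_right add_ac)

definition cbilinear :: "('a::complex_vector \<Rightarrow> 'b::complex_vector \<Rightarrow> 'c::complex_vector) \<Rightarrow> bool"
  where "cbilinear f \<longleftrightarrow> (\<forall>x. clinear (f x)) \<and> (\<forall>y. clinear (\<lambda>x. f x y))"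

definition alg_hom :: "('a::complex_algebra_1 \<Rightarrow> 'b::complex_algebra_1) \<Rightarrow> bool"
  where "alg_hom f \<longleftrightarrow> clinear f \<and> f 1 = 1 \<and> (\<forall>x y. f (x * y) = f x * f y)"

instantiation complex :: complex_algebra_1
begin
definition scaleC_complex :: "complex \<Rightarrow> complex \<Rightarrow> complex"
  where "scaleC_complex = (*)"
instance
  by standard (auto simp: scaleC_complex_def algebra_simps)
end

instantiation vec :: (complex_vector, finite) complex_vector
begin
definition scaleC_vec :: "complex \<Rightarrow> 'a ^ 'b \<Rightarrow> 'a ^ 'b"
  where "scaleC_vec c v = (\<chi> i. c *\<^sub>C (v $ i))"
instance
  by standard (auto simp: scaleC_vec_def vec_eq_iff scaleC_add_right scaleC_add_left scaleC_scaleC scaleC_one)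
end

instantiation poly_mapping :: (type, complex_vector) complex_vector
begin
definition scaleC_poly_mapping :: "complex \<Rightarrow> ('a \<Rightarrow>\<^sub>0 'b) \<Rightarrow> 'a \<Rightarrow>\<^sub>0 'b"
  where "scaleC_poly_mapping c = Poly_Mapping.map (scaleC c)"
lemma lookup_scaleC [simp]:
  "Poly_Mapping.lookup (c *\<^sub>C p) k = c *\<^sub>C Poly_Mapping.lookup p k"
  for p :: "'a \<Rightarrow>\<^sub>0 'b"
  by (simp add: scaleC_poly_mapping_def map.rep_eq when_def)
instance
  by standard
    (auto intro!: poly_mapping_eqI simp: lookup_add scaleC_add_right scaleC_add_left scaleC_scaleC scaleC_one)
end


section \<open>Tensor products\<close>

definition tensor_relators ::
  "(('a::complex_vector \<times> 'b::complex_vector) \<Rightarrow>\<^sub>0 complex) set"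
where
  "tensor_relators =
     {Poly_Mapping.single (x + x', y) 1 - Poly_Mapping.single (x, y) 1 - Poly_Mapping.single (x', y) 1 | x x' y. True}
   \<union> {Poly_Mapping.single (x, y + y') 1 - Poly_Mapping.single (x, y) 1 - Poly_Mapping.single (x, y') 1 | x y y'. True}
   \<union> {Poly_Mapping.single (c *\<^sub>C x, y) 1 - c *\<^sub>C Poly_Mapping.single (x, y) 1 | c x y. True}
   \<union> {Poly_Mapping.single (x, c *\<^sub>C y) 1 - c *\<^sub>C Poly_Mapping.single (x, y) 1 | c x y. True}"

definition tensor_rel ::
  "(('a::complex_vector \<times> 'b::complex_vector) \<Rightarrow>\<^sub>0 complex) \<Rightarrow> (('a \<times> 'b) \<Rightarrow>\<^sub>0 complex) \<Rightarrow> bool"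
where "tensor_rel p p' \<longleftrightarrow> p - p' \<in> complex_vector.span tensor_relators"

lemma equivp_tensor_rel: "equivp (tensor_rel :: (('a::complex_vector \<times> 'b::complex_vector) \<Rightarrow>\<^sub>0 complex) \<Rightarrow> _)"
proof (rule equivpI)
  show "reflp (tensor_rel :: (('a \<times> 'b) \<Rightarrow>\<^sub>0 complex) \<Rightarrow> _)"
    by (rule reflpI) (simp add: tensor_rel_def complex_vector.span_zero)
  show "symp (tensor_rel :: (('a \<times> 'b) \<Rightarrow>\<^sub>0 complex) \<Rightarrow> _)"
    unfolding tensor_rel_def using complex_vector.span_neg by (fastforce intro!: sympI)
  show "transp (tensor_rel :: (('a \<times> 'b) \<Rightarrow>\<^sub>0 complex) \<Rightarrow> _)"
    unfolding tensor_rel_def using complex_vector.span_add by (fastforce intro!: transpI)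
qed

quotient_type (overloaded) ('a, 'b) tensor =
  "('a::complex_vector \<times> 'b::complex_vector) \<Rightarrow>\<^sub>0 complex" / tensor_rel
  morphisms rep_tensor abs_tensor
  by (rule equivp_tensor_rel)

instantiation tensor :: (complex_vector, complex_vector) complex_vector
begin

lift_definition zero_tensor :: "('a, 'b) tensor" is 0 .

lift_definition plus_tensor :: "('a, 'b) tensor \<Rightarrow> ('a, 'b) tensor \<Rightarrow> ('a, 'b) tensor" is "(+)"
proof -
  fix p p' r r' :: "('a \<times> 'b) \<Rightarrow>\<^sub>0 complex"
  assume "tensor_rel p p'" "tensor_rel r r'"
  then have "(p - p') + (r - r') \<in> complex_vector.span tensor_relators"
    unfolding tensor_rel_def by (rule complex_vector.span_add)
  then show "tensor_rel (p + r) (p' + r')"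
    unfolding tensor_rel_def by (simp add: algebra_simps)
qed

lift_definition uminus_tensor :: "('a, 'b) tensor \<Rightarrow> ('a, 'b) tensor" is uminus
proof -
  fix p p' :: "('a \<times> 'b) \<Rightarrow>\<^sub>0 complex"
  assume "tensor_rel p p'"
  then have "- (p - p') \<in> complex_vector.span tensor_relators"
    unfolding tensor_rel_def by (rule complex_vector.span_neg)
  then show "tensor_rel (- p) (- p')"
    unfolding tensor_rel_def by (simp add: algebra_simps)
qed

lift_definition minus_tensor :: "('a, 'b) tensor \<Rightarrow> ('a, 'b) tensor \<Rightarrow> ('a, 'b) tensor" is "(-)"
proof -
  fix p p' r r' :: "('a \<times> 'b) \<Rightarrow>\<^sub>0 complex"
  assume "tensor_rel p p'" "tensor_rel r r'"
  then have "(p - p') - (r - r') \<in> complex_vector.span tensor_relators"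
    unfolding tensor_rel_def by (rule complex_vector.span_diff)
  then show "tensor_rel (p - r) (p' - r')"
    unfolding tensor_rel_def by (simp add: algebra_simps)
qed

lift_definition scaleC_tensor :: "complex \<Rightarrow> ('a, 'b) tensor \<Rightarrow> ('a, 'b) tensor" is scaleC
  unfolding tensor_rel_def complex_vector.scale_right_diff_distrib[symmetric]
  by (rule complex_vector.span_scale)

instance
proof
  fix c d :: complex and x y z :: "('a, 'b) tensor"
  have refl: "p = p' \<Longrightarrow> tensor_rel p p'" for p p' :: "('a \<times> 'b) \<Rightarrow>\<^sub>0 complex"
    by (simp add: tensor_rel_def complex_vector.span_zero)
  show "x + y + z = x + (y + z)" by transfer (rule refl, simp add: algebra_simps)
  show "x + y = y + x" by transfer (rule refl, simp add: algebra_simps)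
  show "0 + x = x" by transfer (rule refl, simp)
  show "- x + x = 0" by transfer (rule refl, simp)
  show "x - y = x + - y" by transfer (rule refl, simp)
  show "c *\<^sub>C (x + y) = c *\<^sub>C x + c *\<^sub>C y" by transfer (rule refl, simp add: scaleC_add_right)
  show "(c + d) *\<^sub>C x = c *\<^sub>C x + d *\<^sub>C x" by transfer (rule refl, simp add: scaleC_add_left)
  show "c *\<^sub>C d *\<^sub>C x = (c * d) *\<^sub>C x" by transfer (rule refl, simp add: scaleC_scaleC)
  show "1 *\<^sub>C x = x" by transfer (rule refl, simp add: scaleC_one)
qed

end

lift_definition tens :: "'a::complex_vector \<Rightarrow> 'b::complex_vector \<Rightarrow> ('a, 'b) tensor"  (infixr \<open>\<otimes>\<close> 72)
  is "\<lambda>x y. Poly_Mapping.single (x, y) 1" .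

lemma tens_add_left: "(x + x') \<otimes> y = x \<otimes> y + x' \<otimes> y"
  by transfer (unfold tensor_rel_def tensor_relators_def diff_diff_eq[symmetric],
      rule complex_vector.span_base, blast)

lemma tens_add_right: "x \<otimes> (y + y') = x \<otimes> y + x \<otimes> y'"
  by transfer (unfold tensor_rel_def tensor_relators_def diff_diff_eq[symmetric],
      rule complex_vector.span_base, blast)

lemma tens_scaleC_left: "(c *\<^sub>C x) \<otimes> y = c *\<^sub>C (x \<otimes> y)"
  by transfer (unfold tensor_rel_def tensor_relators_def, rule complex_vector.span_base, blast)

lemma tens_scaleC_right: "x \<otimes> (c *\<^sub>C y) = c *\<^sub>C (x \<otimes> y)"
  by transfer (unfold tensor_rel_def tensor_relators_def, rule complex_vector.span_base, blast)

lemma cbilinear_tens: "cbilinear (\<otimes>)"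
  by (auto simp: cbilinear_def intro!: clinearI
      simp: tens_add_left tens_add_right tens_scaleC_left tens_scaleC_right)

lemma tensor_induct [case_names tens add]:
  assumes t: "\<And>x y. P (x \<otimes> y)" and a: "\<And>u v. P u \<Longrightarrow> P v \<Longrightarrow> P (u + v)"
  shows "P z"
proof -
  have *: "P (abs_tensor p)" for p
  proof (induction p rule: update_induct)
    case const
    have "abs_tensor (0 :: ('a \<times> 'b) \<Rightarrow>\<^sub>0 complex) = 0 \<otimes> 0"
      using tens_scaleC_left[of 0 "0::'a" "0::'b"] unfolding zero_tensor.abs_eq[symmetric] by simp
    then show ?case using t[of 0 0] by simp
  next
    case (update p k v)
    obtain x y where k: "k = (x, y)" by (cases k)
    have "Poly_Mapping.update k v p = p + v *\<^sub>C Poly_Mapping.single (x, y) 1"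
      using update.hyps
      by (intro poly_mapping_eqI)
        (auto simp: k lookup_add lookup_single lookup_update when_def scaleC_complex_def in_keys_iff)
    then have "abs_tensor (Poly_Mapping.update k v p) = abs_tensor p + (v *\<^sub>C x) \<otimes> y"
      by (simp add: plus_tensor.abs_eq[symmetric] scaleC_tensor.abs_eq[symmetric]
          tens.abs_eq[symmetric] tens_scaleC_left)
    then show ?case using a[OF update.IH t] by simp
  qed
  from this[of "rep_tensor z"] show ?thesis by (simp add: Quotient3_abs_rep[OF Quotient3_tensor])
qed

text \<open>
  The linear map on the tensor product that a bilinear map f induces. With the coproduct \<open>\<Delta>\<close>,
  \<open>tensor_lift f (\<Delta> h)\<close> is the Sweedler expression \<open>f h\<^sub>1 h\<^sub>2\<close>.
  The definition is meaningful only for bilinear f; see \<open>tensor_lift_tens\<close> below.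
\<close>

definition free_lift :: "('a \<Rightarrow> 'b \<Rightarrow> 'c::complex_vector) \<Rightarrow> (('a \<times> 'b) \<Rightarrow>\<^sub>0 complex) \<Rightarrow> 'c"
  where "free_lift f p =
    (\<Sum>k\<in>Poly_Mapping.keys p. Poly_Mapping.lookup p k *\<^sub>C f (fst k) (snd k))"

definition tensor_lift ::
  "('a::complex_vector \<Rightarrow> 'b::complex_vector \<Rightarrow> 'c::complex_vector) \<Rightarrow> ('a, 'b) tensor \<Rightarrow> 'c"
  where "tensor_lift f z = free_lift f (rep_tensor z)"

lemma free_lift_superset:
  assumes "finite A" "Poly_Mapping.keys p \<subseteq> A"
  shows "free_lift f p = (\<Sum>k\<in>A. Poly_Mapping.lookup p k *\<^sub>C f (fst k) (snd k))"
  unfolding free_lift_def using assms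
  by (intro sum.mono_neutral_left) (auto simp: in_keys_iff)

lemma clinear_free_lift: "clinear (free_lift f)"
proof (rule clinearI)
  fix p p' :: "('a \<times> 'b) \<Rightarrow>\<^sub>0 complex" and c
  let ?A = "Poly_Mapping.keys p \<union> Poly_Mapping.keys p'"
  have "free_lift f (p + p') = (\<Sum>k\<in>?A. Poly_Mapping.lookup (p + p') k *\<^sub>C f (fst k) (snd k))"
    by (rule free_lift_superset) (use Poly_Mapping.keys_add[of p p'] in auto)
  also have "\<dots> = free_lift f p + free_lift f p'"
    by (simp add: free_lift_superset[of ?A] lookup_add scaleC_add_left sum.distrib)
  finally show "free_lift f (p + p') = free_lift f p + free_lift f p'" .
  have "free_lift f (c *\<^sub>C p) =
      (\<Sum>k\<in>Poly_Mapping.keys p. Poly_Mapping.lookup (c *\<^sub>C p) k *\<^sub>C f (fst k) (snd k))"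
    by (rule free_lift_superset) (auto simp: in_keys_iff scaleC_complex_def)
  also have "\<dots> = c *\<^sub>C free_lift f p"
    by (simp add: free_lift_def complex_vector.scale_sum_right scaleC_complex_def)
  finally show "free_lift f (c *\<^sub>C p) = c *\<^sub>C free_lift f p" .
qed

lemma free_lift_single: "free_lift f (Poly_Mapping.single (x, y) 1) = f x y"
  by (simp add: free_lift_def)

lemma free_lift_relators:
  assumes f: "cbilinear f" and p: "p \<in> complex_vector.span tensor_relators"
  shows "free_lift f p = 0"
proof -
  interpret F: Vector_Spaces.linear scaleC scaleC "free_lift f" by (rule clinear_free_lift)
  have l: "clinear (f x)" "clinear (\<lambda>x. f x y)" for x y using f by (auto simp: cbilinear_def)
  show ?thesis
    using p
  proof (rule F.eq_0_on_span[rotated])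
    fix r :: "('a \<times> 'b) \<Rightarrow>\<^sub>0 complex"
    assume "r \<in> tensor_relators"
    then show "free_lift f r = 0"
      unfolding tensor_relators_def
      by (auto simp: F.diff F.scale free_lift_single
          clinear_add[OF l(1)] clinear_add[OF l(2)] clinear_scaleC[OF l(1)] clinear_scaleC[OF l(2)])
  qed
qed

lemma tensor_lift_abs:
  assumes f: "cbilinear f"
  shows "tensor_lift f (abs_tensor p) = free_lift f p"
proof -
  interpret F: Vector_Spaces.linear scaleC scaleC "free_lift f" by (rule clinear_free_lift)
  have "tensor_rel (rep_tensor (abs_tensor p)) p"
    by (rule Quotient3_rep_abs[OF Quotient3_tensor]) (simp add: tensor_rel_def complex_vector.span_zero)
  from free_lift_relators[OF f this[unfolded tensor_rel_def]]
  show ?thesis by (simp add: tensor_lift_def F.diff)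
qed

lemma tensor_lift_tens: "cbilinear f \<Longrightarrow> tensor_lift f (x \<otimes> y) = f x y"
  by (simp add: tens.abs_eq tensor_lift_abs free_lift_single)

lemma abs_rep_tensor: "abs_tensor (rep_tensor z) = z"
  by (rule Quotient3_abs_rep[OF Quotient3_tensor])

lemma clinear_tensor_lift:
  assumes f: "cbilinear f"
  shows "clinear (tensor_lift f)"
proof (rule clinearI)
  fix u v :: "('a, 'b) tensor" and c
  have "tensor_lift f (abs_tensor (rep_tensor u) + abs_tensor (rep_tensor v)) = tensor_lift f u + tensor_lift f v"
    unfolding plus_tensor.abs_eq tensor_lift_abs[OF f] clinear_add[OF clinear_free_lift]
    by (simp add: tensor_lift_def)
  then show "tensor_lift f (u + v) = tensor_lift f u + tensor_lift f v" by (simp add: abs_rep_tensor)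
  have "tensor_lift f (c *\<^sub>C abs_tensor (rep_tensor u)) = c *\<^sub>C tensor_lift f u"
    unfolding scaleC_tensor.abs_eq tensor_lift_abs[OF f] clinear_scaleC[OF clinear_free_lift]
    by (simp add: tensor_lift_def)
  then show "tensor_lift f (c *\<^sub>C u) = c *\<^sub>C tensor_lift f u" by (simp add: abs_rep_tensor)
qed

lemma tensor_lift_add: "cbilinear f \<Longrightarrow> tensor_lift f (u + v) = tensor_lift f u + tensor_lift f v"
  by (rule clinear_add[OF clinear_tensor_lift])

lemma tensor_lift_scaleC: "cbilinear f \<Longrightarrow> tensor_lift f (c *\<^sub>C u) = c *\<^sub>C tensor_lift f u"
  by (rule clinear_scaleC[OF clinear_tensor_lift])

definition tensor_map ::
  "('a::complex_vector \<Rightarrow> 'c::complex_vector) \<Rightarrow> ('b::complex_vector \<Rightarrow> 'd::complex_vector)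
    \<Rightarrow> ('a, 'b) tensor \<Rightarrow> ('c, 'd) tensor"
  where "tensor_map f g = tensor_lift (\<lambda>x y. f x \<otimes> g y)"

definition tensor_assoc ::
  "(('a::complex_vector, 'b::complex_vector) tensor, 'c::complex_vector) tensor \<Rightarrow> ('a, ('b, 'c) tensor) tensor"
  where "tensor_assoc = tensor_lift (\<lambda>u z. tensor_lift (\<lambda>x y. x \<otimes> (y \<otimes> z)) u)"

subsection \<open>The tensor product of two algebras\<close>

instantiation tensor :: (complex_algebra_1, complex_algebra_1) "{one, times}"
begin
definition one_tensor :: "('a, 'b) tensor" where "one_tensor = 1 \<otimes> 1"
definition times_tensor :: "('a, 'b) tensor \<Rightarrow> ('a, 'b) tensor \<Rightarrow> ('a, 'b) tensor"
  where "u * v = tensor_lift (\<lambda>x y. tensor_lift (\<lambda>x' y'. (x * x') \<otimes> (y * y')) v) u"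
instance ..
end

lemma cbilinear_tensor_times_inner:
  "cbilinear (\<lambda>x' y'. ((x::'a::complex_algebra_1) * x') \<otimes> ((y::'b::complex_algebra_1) * y'))"
  by (auto simp: cbilinear_def distrib_left mult_scaleC_right
      tens_add_left tens_add_right tens_scaleC_left tens_scaleC_right intro!: clinearI)

lemma cbilinear_tensor_times_outer:
  "cbilinear (\<lambda>x y. tensor_lift (\<lambda>x' y'. ((x::'a::complex_algebra_1) * x') \<otimes> ((y::'b::complex_algebra_1) * y')) v)"
proof (induction v rule: tensor_induct)
  case (tens x' y')
  show ?case
    by (auto simp: tensor_lift_tens[OF cbilinear_tensor_times_inner] cbilinear_def distrib_right mult_scaleC_left
        tens_add_left tens_add_right tens_scaleC_left tens_scaleC_right intro!: clinearI)
next
  case (add u v)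
  let ?f = "\<lambda>w x y. tensor_lift (\<lambda>x' y'. (x * x') \<otimes> (y * y')) w"
  have l: "clinear (?f u x)" "clinear (?f v x)" "clinear (\<lambda>x. ?f u x y)" "clinear (\<lambda>x. ?f v x y)" for x y
    using add by (simp_all add: cbilinear_def)
  have "clinear (\<lambda>y. ?f u x y + ?f v x y)" "clinear (\<lambda>x. ?f u x y + ?f v x y)" for x y
    using clinear_add_fun[OF l(1,2)] clinear_add_fun[OF l(3,4)] by auto
  then show ?case
    by (simp add: tensor_lift_add[OF cbilinear_tensor_times_inner] cbilinear_def)
qed

lemma tens_mult:
  "(x \<otimes> y) * v = tensor_lift (\<lambda>x' y'. (x * x') \<otimes> (y * y')) v"
  unfolding times_tensor_def by (rule tensor_lift_tens[OF cbilinear_tensor_times_outer])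

lemma tens_mult_tens: "(x \<otimes> y) * (x' \<otimes> y') = (x * x') \<otimes> (y * y')"
  by (simp add: tens_mult tensor_lift_tens[OF cbilinear_tensor_times_inner])

lemma tensor_times_add_left: "(u + u') * v = u * v + u' * (v :: ('a::complex_algebra_1, 'b::complex_algebra_1) tensor)"
  by (simp add: times_tensor_def tensor_lift_add[OF cbilinear_tensor_times_outer])

lemma tensor_times_scaleC_left: "(c *\<^sub>C u) * v = c *\<^sub>C (u * (v :: ('a::complex_algebra_1, 'b::complex_algebra_1) tensor))"
  by (simp add: times_tensor_def tensor_lift_scaleC[OF cbilinear_tensor_times_outer])

lemma tensor_times_add_right: "u * (v + v') = u * v + u * (v' :: ('a::complex_algebra_1, 'b::complex_algebra_1) tensor)"
proof (induction u rule: tensor_induct)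
  case (tens x y)
  show ?case
    by (simp add: tens_mult tensor_lift_add[OF cbilinear_tensor_times_inner])
qed (simp add: tensor_times_add_left algebra_simps)

lemma tensor_times_scaleC_right: "u * (c *\<^sub>C v) = c *\<^sub>C (u * (v :: ('a::complex_algebra_1, 'b::complex_algebra_1) tensor))"
proof (induction u rule: tensor_induct)
  case (tens x y)
  show ?case
    by (simp add: tens_mult tensor_lift_scaleC[OF cbilinear_tensor_times_inner])
qed (simp add: tensor_times_add_left scaleC_add_right)

lemma tensor_times_assoc: "u * v * w = u * (v * (w :: ('a::complex_algebra_1, 'b::complex_algebra_1) tensor))"
proof (induction u rule: tensor_induct)
  case u: (tens x y)
  show ?case
  proof (induction v rule: tensor_induct)
    case v: (tens x' y')
    show ?case
      by (induction w rule: tensor_induct) (auto simp: tens_mult_tens mult.assoc tensor_times_add_right)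
  qed (simp add: tensor_times_add_left tensor_times_add_right)
qed (simp add: tensor_times_add_left)

lemma tensor_times_one:
  "1 * u = (u :: ('a::complex_algebra_1, 'b::complex_algebra_1) tensor)" "u * 1 = u"
  by (induction u rule: tensor_induct)
    (auto simp: one_tensor_def tens_mult_tens tensor_times_add_left tensor_times_add_right)

lemma ex_functional_one: "\<exists>f :: 'a::complex_algebra_1 \<Rightarrow> complex. clinear f \<and> f 1 = 1"
proof -
  let ?B = "complex_vector.extend_basis {1 :: 'a}"
  have i: "complex_vector.independent {1 :: 'a}" by simp
  have B: "complex_vector.independent ?B" "complex_vector.span ?B = UNIV" "1 \<in> ?B"
    using complex_vector.independent_extend_basis[OF i] complex_vector.span_extend_basis[OF i]
      complex_vector.extend_basis_superset[OF i] by auto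
  let ?f = "\<lambda>x. complex_vector.representation ?B x (1 :: 'a)"
  have "clinear ?f"
    by (rule clinearI)
      (simp_all add: complex_vector.representation_add complex_vector.representation_scale B scaleC_complex_def)
  moreover have "?f 1 = 1"
    by (simp add: complex_vector.representation_basis B)
  ultimately show ?thesis by blast
qed

lemma tensor_one_neq_zero: "(1 :: ('a::complex_algebra_1, 'b::complex_algebra_1) tensor) \<noteq> 0"
proof -
  obtain f :: "'a \<Rightarrow> complex" where f: "clinear f" "f 1 = 1" using ex_functional_one by blast
  obtain g :: "'b \<Rightarrow> complex" where g: "clinear g" "g 1 = 1" using ex_functional_one by blast
  have b: "cbilinear (\<lambda>x y. f x * g y)"
    unfolding cbilinear_def
    by (intro conjI allI clinearI)
      (simp_all add: clinear_add[OF f(1)] clinear_scaleC[OF f(1)] clinear_add[OF g(1)]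
        clinear_scaleC[OF g(1)] scaleC_complex_def algebra_simps)
  have "tensor_lift (\<lambda>x y. f x * g y) 1 = 1"
    by (simp add: one_tensor_def tensor_lift_tens[OF b] f g)
  moreover have "tensor_lift (\<lambda>x y. f x * g y) 0 = 0"
    using tensor_lift_scaleC[OF b, of 0 0] by (simp add: complex_vector.scale_zero_left)
  ultimately show ?thesis by auto
qed

instance tensor :: (complex_algebra_1, complex_algebra_1) complex_algebra_1
  by standard (rule tensor_times_assoc tensor_times_one tensor_times_add_left tensor_times_add_right
      tensor_times_scaleC_left tensor_times_scaleC_right tensor_one_neq_zero[symmetric])+


section \<open>Algebras given by generators and relations\<close>

datatype 'g free_monoid = Word (letters: "'g list")

instantiation free_monoid :: (type) monoid_add
begin
definition zero_free_monoid :: "'a free_monoid" where "0 = Word []"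
definition plus_free_monoid :: "'a free_monoid \<Rightarrow> 'a free_monoid \<Rightarrow> 'a free_monoid"
  where "u + v = Word (letters u @ letters v)"
instance by standard (auto simp: zero_free_monoid_def plus_free_monoid_def)
end

text \<open>The multiplication of \<open>\<Rightarrow>\<^sub>0\<close> is convolution, so this type carries the free algebra on 'g.\<close>

type_synonym 'g free_algebra = "'g free_monoid \<Rightarrow>\<^sub>0 complex"

definition gen :: "'g \<Rightarrow> 'g free_algebra"
  where "gen g = Poly_Mapping.single (Word [g]) 1"

definition free_eval :: "('g \<Rightarrow> 'a::complex_algebra_1) \<Rightarrow> 'g free_algebra \<Rightarrow> 'a"
  where "free_eval x p = (\<Sum>w\<in>Poly_Mapping.keys p.
           Poly_Mapping.lookup p w *\<^sub>C prod_list (map x (letters w)))"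

definition two_sided_ideal :: "'g free_algebra set \<Rightarrow> 'g free_algebra set"
  where "two_sided_ideal X = complex_vector.span {u * r * v | u r v. r \<in> X}"

text \<open>The algebra 'a is, via the images x of the generators, the free algebra modulo the relators X.\<close>

definition presented_by :: "('g \<Rightarrow> 'a::complex_algebra_1) \<Rightarrow> 'g free_algebra set \<Rightarrow> bool"
  where "presented_by x X \<longleftrightarrow>
           surj (free_eval x) \<and> {p. free_eval x p = 0} = two_sided_ideal X"


section \<open>Dual-quasitriangular Hopf algebras\<close>

locale hopf_algebra =
  fixes \<Delta> :: "'h::complex_algebra_1 \<Rightarrow> ('h, 'h) tensor"
    and \<epsilon> :: "'h \<Rightarrow> complex"
    and S :: "'h \<Rightarrow> 'h"
  assumes coproduct_alg_hom: "alg_hom \<Delta>"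
    and counit_alg_hom: "alg_hom \<epsilon>"
    and antipode_linear: "clinear S"
    and coassoc: "tensor_assoc (tensor_map \<Delta> id (\<Delta> h)) = tensor_map id \<Delta> (\<Delta> h)"
    and counit_left: "tensor_lift (\<lambda>x y. \<epsilon> x *\<^sub>C y) (\<Delta> h) = h"
    and counit_right: "tensor_lift (\<lambda>x y. \<epsilon> y *\<^sub>C x) (\<Delta> h) = h"
    and antipode_left: "tensor_lift (\<lambda>x y. S x * y) (\<Delta> h) = \<epsilon> h *\<^sub>C 1"
    and antipode_right: "tensor_lift (\<lambda>x y. x * S y) (\<Delta> h) = \<epsilon> h *\<^sub>C 1"

text \<open>The convolution product of functionals on the coalgebra \<open>H \<otimes> H\<close>, evaluated at \<open>x \<otimes> y\<close>.\<close>

definition convolution ::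
  "('h::complex_algebra_1 \<Rightarrow> ('h, 'h) tensor) \<Rightarrow> (('h, 'h) tensor \<Rightarrow> complex)
    \<Rightarrow> (('h, 'h) tensor \<Rightarrow> complex) \<Rightarrow> 'h \<Rightarrow> 'h \<Rightarrow> complex"
  where "convolution \<Delta> R R' x y =
    tensor_lift (\<lambda>x1 x2. tensor_lift (\<lambda>y1 y2. R (x1 \<otimes> y1) * R' (x2 \<otimes> y2)) (\<Delta> y)) (\<Delta> x)"

locale dual_quasitriangular_hopf_algebra = hopf_algebra \<Delta> \<epsilon> S
  for \<Delta> :: "'h::complex_algebra_1 \<Rightarrow> ('h, 'h) tensor" and \<epsilon> S +
  fixes R :: "('h, 'h) tensor \<Rightarrow> complex"
  assumes R_linear: "clinear R"
    and R_invertible: "\<exists>R'. clinear R' \<and>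
          (\<forall>x y. convolution \<Delta> R R' x y = \<epsilon> x * \<epsilon> y \<and> convolution \<Delta> R' R x y = \<epsilon> x * \<epsilon> y)"
    and R_mult_left: "R ((x * y) \<otimes> z) =
          tensor_lift (\<lambda>z1 z2. R (x \<otimes> z1) * R (y \<otimes> z2)) (\<Delta> z)"
    and R_mult_right: "R (x \<otimes> (y * z)) =
          tensor_lift (\<lambda>x1 x2. R (x1 \<otimes> z) * R (x2 \<otimes> y)) (\<Delta> x)"
    and R_quasicommutative:
          "tensor_lift (\<lambda>x1 x2. tensor_lift (\<lambda>y1 y2. R (x2 \<otimes> y2) *\<^sub>C (y1 * x1)) (\<Delta> y)) (\<Delta> x)
         = tensor_lift (\<lambda>x1 x2. tensor_lift (\<lambda>y1 y2. R (x1 \<otimes> y1) *\<^sub>C (x2 * y2)) (\<Delta> y)) (\<Delta> x)"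


section \<open>The braided-Killing form\<close>

text \<open>
  Here \<open>\<rho> \<alpha> \<beta>\<close> is the matrix \<open>\<rho>\<^sup>\<alpha>\<^sub>\<beta>\<close> over H of a right comodule W with a chosen basis indexed by 'n,
  and \<open>V = End(W)\<close> is the space of matrices whose row index is the upper one:
  \<open>\<phi> $ \<alpha> $ \<beta>\<close> is \<open>\<phi>\<^sup>\<alpha>\<^sub>\<beta>\<close>.
\<close>

definition Q_map ::
  "('h::complex_algebra_1 \<Rightarrow> ('h, 'h) tensor) \<Rightarrow> (('h, 'h) tensor \<Rightarrow> complex) \<Rightarrow> 'h \<Rightarrow> 'h \<Rightarrow> complex"
  where "Q_map \<Delta> R h g =
    tensor_lift (\<lambda>g1 g2. tensor_lift (\<lambda>h1 h2. R (g1 \<otimes> h1) * R (h2 \<otimes> g2)) (\<Delta> h)) (\<Delta> g)"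

definition rho_Q ::
  "('h::complex_algebra_1 \<Rightarrow> ('h, 'h) tensor) \<Rightarrow> (('h, 'h) tensor \<Rightarrow> complex)
    \<Rightarrow> ('n::finite \<Rightarrow> 'n \<Rightarrow> 'h) \<Rightarrow> 'h \<Rightarrow> complex ^ 'n ^ 'n"
  where "rho_Q \<Delta> R \<rho> h = (\<chi> \<alpha> \<beta>. Q_map \<Delta> R h (\<rho> \<alpha> \<beta>))"

definition killing_tau :: "('h::complex_algebra_1 \<Rightarrow> 'h) \<Rightarrow> ('n::finite \<Rightarrow> 'n \<Rightarrow> 'h) \<Rightarrow> 'h"
  where "killing_tau S \<rho> = (\<Sum>\<alpha>\<in>UNIV. \<rho> \<alpha> \<alpha>) * S (\<Sum>\<beta>\<in>UNIV. \<rho> \<beta> \<beta>)"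

definition killing_T ::
  "('h::complex_algebra_1 \<Rightarrow> ('h, 'h) tensor) \<Rightarrow> ('h \<Rightarrow> 'h) \<Rightarrow> (('h, 'h) tensor \<Rightarrow> complex)
    \<Rightarrow> ('n::finite \<Rightarrow> 'n \<Rightarrow> 'h) \<Rightarrow> 'h"
  where "killing_T \<Delta> S R \<rho> =
    tensor_lift (\<lambda>x1 x. tensor_lift (\<lambda>x2 x3. R (x1 \<otimes> S x2) *\<^sub>C x3) (\<Delta> x)) (\<Delta> (killing_tau S \<rho>))"

definition braided_killing_form ::
  "('h::complex_algebra_1 \<Rightarrow> ('h, 'h) tensor) \<Rightarrow> ('h \<Rightarrow> complex) \<Rightarrow> ('h \<Rightarrow> 'h)
    \<Rightarrow> (('h, 'h) tensor \<Rightarrow> complex) \<Rightarrow> ('n::finite \<Rightarrow> 'n \<Rightarrow> 'h)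
    \<Rightarrow> (complex ^ 'n ^ 'n, complex ^ 'n ^ 'n) tensor"
  where "braided_killing_form \<Delta> \<epsilon> S R \<rho> =
    (let T = killing_T \<Delta> S R \<rho>; \<rho>Q = rho_Q \<Delta> R \<rho> in
       tensor_map \<rho>Q \<rho>Q (\<Delta> T) - mat 1 \<otimes> \<rho>Q T - \<rho>Q T \<otimes> mat 1 + \<epsilon> T *\<^sub>C (mat 1 \<otimes> mat 1))"


section \<open>The quantum group\<close>

definition SU2_relators :: "complex \<Rightarrow> (2 \<times> 2) free_algebra set"
  where "SU2_relators q =
    (let a = gen (1, 1); b = gen (1, 2); c = gen (2, 1); d = gen (2, 2) in
      {b * a - q *\<^sub>C (a * b), c * a - q *\<^sub>C (a * c), d * b - q *\<^sub>C (b * d), d * c - q *\<^sub>C (c * d),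
       b * c - c * b, d * a - a * d - (q - inverse q) *\<^sub>C (b * c), a * d - inverse q *\<^sub>C (b * c) - 1})"

text \<open>
  \<open>R_matrix q r i j k l\<close> is \<open>R\<^sup>i\<^sub>j\<^sup>k\<^sub>l\<close>; the parameter r is a choice of square root of q.
\<close>

definition R_matrix :: "complex \<Rightarrow> complex \<Rightarrow> 2 \<Rightarrow> 2 \<Rightarrow> 2 \<Rightarrow> 2 \<Rightarrow> complex"
  where "R_matrix q r i j k l =
    (if (i, j, k, l) \<in> {(1, 1, 1, 1), (2, 2, 2, 2)} then inverse r * q
     else if (i, j, k, l) \<in> {(1, 1, 2, 2), (2, 2, 1, 1)} then inverse r
     else if (i, j, k, l) = (1, 2, 2, 1) then inverse r * (q - inverse q)
     else 0)"

text \<open>The generators a, b, c, d are \<open>t 1 1\<close>, \<open>t 1 2\<close>, \<open>t 2 1\<close>, \<open>t 2 2\<close>.\<close>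

locale quantum_SU2 = dual_quasitriangular_hopf_algebra \<Delta> \<epsilon> S R
  for \<Delta> :: "'h::complex_algebra_1 \<Rightarrow> ('h, 'h) tensor" and \<epsilon> S R +
  fixes q r :: complex and t :: "2 \<Rightarrow> 2 \<Rightarrow> 'h"
  assumes q_nonzero: "q \<noteq> 0"
    and q_generic: "n > 0 \<Longrightarrow> q ^ n \<noteq> 1"
    and sqrt_q: "r\<^sup>2 = q"
    and presentation: "presented_by (\<lambda>(i, j). t i j) (SU2_relators q)"
    and coproduct_t: "\<Delta> (t i j) = (\<Sum>k\<in>UNIV. t i k \<otimes> t k j)"
    and counit_t: "\<epsilon> (t i j) = (if i = j then 1 else 0)"
    and antipode_t: "S (t 1 1) = t 2 2" "S (t 2 2) = t 1 1"
          "S (t 1 2) = - q *\<^sub>C t 1 2" "S (t 2 1) = - inverse q *\<^sub>C t 2 1"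
    and R_t: "R (t i j \<otimes> t k l) = R_matrix q r i j k l"

definition matrix_unit :: "2 \<Rightarrow> 2 \<Rightarrow> complex ^ 2 ^ 2"
  where "matrix_unit \<alpha> \<beta> = (\<chi> i j. if i = \<alpha> \<and> j = \<beta> then 1 else 0)"

text \<open>The basis vector \<open>e\<^sub>b\<close> is \<open>e\<^sub>2 \<otimes> f\<^sup>1\<close> and \<open>e\<^sub>c\<close> is \<open>e\<^sub>1 \<otimes> f\<^sup>2\<close>, transposed relative to
  the names b, c of the generators.\<close>

definition "e_a = matrix_unit 1 1"
definition "e_b = matrix_unit 2 1"
definition "e_c = matrix_unit 1 2"
definition "e_d = matrix_unit 2 2"

definition theta :: "complex ^ 2 ^ 2"
  where "theta = e_a + e_d"

definition q_number :: "nat \<Rightarrow> complex \<Rightarrow> complex"  (\<open>[_]\<^bsub>_\<^esub>\<close>)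
  where "[n]\<^bsub>q\<^esub> = (1 - q ^ n) / (1 - q)"

definition eta_K :: "complex \<Rightarrow> (complex ^ 2 ^ 2, complex ^ 2 ^ 2) tensor"
  where "eta_K q = e_b \<otimes> e_c + q\<^sup>2 *\<^sub>C (e_c \<otimes> e_b)
    + inverse [2]\<^bsub>q\<^esub> *\<^sub>C (e_a \<otimes> e_a - q *\<^sub>C (e_a \<otimes> e_d) - q *\<^sub>C (e_d \<otimes> e_a)
        + (q * (q\<^sup>2 + q - 1)) *\<^sub>C (e_d \<otimes> e_d))"

end

theory Submission
  imports Defs
begin

text \<open>
  The element \<open>\<tau>\<close> is the trace of the \<open>4 \<times> 4\<close> corepresentation \<open>u = t \<otimes> t\<close>, because \<open>S (a + d) = a + d\<close>.
  Hence \<open>T = \<Sum>\<^sub>i\<^sub>j v\<^sub>i\<^sub>j u\<^sub>j\<^sub>i\<close> with \<open>v\<^sub>i\<^sub>j = \<Sum>\<^sub>k R (u\<^sub>i\<^sub>k \<otimes> S u\<^sub>k\<^sub>j)\<close>, and since \<open>\<Delta> u = u \<otimes> u\<close> as a matrix product, the four terms of the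
  braided-Killing form combine to \<open>\<Sum>\<^sub>i\<^sub>j\<^sub>k v\<^sub>i\<^sub>j N\<^sub>j\<^sub>k \<otimes> N\<^sub>k\<^sub>i\<close>, where \<open>N = \<rho>Q u - \<epsilon> u\<close>. The numbers \<open>v\<close> and the
  matrices \<open>N\<close> follow from the R-matrix by multiplicativity of R.
\<close>

section \<open>Linear and bilinear maps\<close>

lemma clinear_sum: "clinear f \<Longrightarrow> f (\<Sum>i\<in>A. g i) = (\<Sum>i\<in>A. f (g i))"
  by (metis linear_def module_hom.sum Vector_Spaces.linear.axioms(3))

lemma clinear_zero: "clinear f \<Longrightarrow> f 0 = 0"
  using clinear_scaleC[of f 0 0] by simp

lemma clinear_diff: "clinear f \<Longrightarrow> f (x - y) = f x - f y"
  by (metis clinear_add diff_add_cancel add_diff_cancel)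

lemma cbilinearI:
  assumes "\<And>x y y'. f x (y + y') = f x y + f x y'" "\<And>x c y. f x (c *\<^sub>C y) = c *\<^sub>C f x y"
    and "\<And>x x' y. f (x + x') y = f x y + f x' y" "\<And>c x y. f (c *\<^sub>C x) y = c *\<^sub>C f x y"
  shows "cbilinear f"
  unfolding cbilinear_def by (intro conjI allI clinearI assms)

lemma cbilinearD:
  assumes "cbilinear f"
  shows "f x (y + y') = f x y + f x y'" "f x (c *\<^sub>C y) = c *\<^sub>C f x y"
    "f (x + x') y = f x y + f x' y" "f (c *\<^sub>C x) y = c *\<^sub>C f x y"
proof -
  have "clinear (f x)" "clinear (\<lambda>x. f x y)" using assms by (auto simp: cbilinear_def)
  from clinear_add[OF this(1)] clinear_scaleC[OF this(1)] clinear_add[OF this(2)] clinear_scaleC[OF this(2)]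
  show "f x (y + y') = f x y + f x y'" "f x (c *\<^sub>C y) = c *\<^sub>C f x y"
    "f (x + x') y = f x y + f x' y" "f (c *\<^sub>C x) y = c *\<^sub>C f x y" .
qed

lemma tensor_lift_sum:
  "cbilinear f \<Longrightarrow> tensor_lift f (\<Sum>i\<in>A. x i \<otimes> y i) = (\<Sum>i\<in>A. f (x i) (y i))"
  by (simp add: clinear_sum clinear_tensor_lift tensor_lift_tens)

text \<open>Nested Sweedler expressions make sense only if every layer is bilinear. Induction on
  \<open>u\<close>: on a pure tensor the claim is bilinearity of \<open>f\<close> in its outer pair,
  and sums of bilinear maps stay bilinear.\<close>

lemma cbilinear_tensor_lift:
  assumes "\<And>x y. cbilinear (f x y)" "\<And>v w. cbilinear (\<lambda>x y. f x y v w)"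
  shows "cbilinear (\<lambda>x y. tensor_lift (f x y) u)"
proof (induction u rule: tensor_induct)
  case (tens v w)
  then show ?case using assms(2)[of v w] by (simp add: tensor_lift_tens assms(1))
next
  case (add u v)
  then show ?case
    by (intro cbilinearI) (simp_all add: tensor_lift_add assms(1) cbilinearD[OF add(1)] cbilinearD[OF add(2)] scaleC_add_right)
qed

lemma cbilinear_clinear_comp:
  assumes "cbilinear f" "clinear g" "clinear h"
  shows "cbilinear (\<lambda>x y. f (g x) (h y))"
  by (intro cbilinearI)
    (simp_all add: cbilinearD[OF assms(1)] clinear_add[OF assms(2)] clinear_add[OF assms(3)]
      clinear_scaleC[OF assms(2)] clinear_scaleC[OF assms(3)])

lemma cbilinear_mult: "cbilinear ((*) :: 'a::complex_algebra_1 \<Rightarrow> _)"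
  by (intro cbilinearI) (simp_all add: algebra_simps mult_scaleC_left mult_scaleC_right)

lemma cbilinear_scaleC: "cbilinear (scaleC :: complex \<Rightarrow> 'a::complex_vector \<Rightarrow> 'a)"
  by (intro cbilinearI) (simp_all add: scaleC_add_left scaleC_add_right scaleC_scaleC scaleC_complex_def mult.commute)

lemma clinear_id: "clinear (\<lambda>x. x)"
  by (rule clinearI) auto

lemma clinear_comp: "clinear f \<Longrightarrow> clinear g \<Longrightarrow> clinear (\<lambda>x. f (g x))"
  by (rule clinearI) (simp_all add: clinear_add clinear_scaleC)

lemma clinear_tens_left: "clinear f \<Longrightarrow> clinear (\<lambda>x. f (x \<otimes> y))"
  by (rule clinearI) (simp_all add: tens_add_left tens_scaleC_left clinear_add clinear_scaleC)

lemma clinear_tens_right: "clinear f \<Longrightarrow> clinear (\<lambda>y. f (x \<otimes> y))"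
  by (rule clinearI) (simp_all add: tens_add_right tens_scaleC_right clinear_add clinear_scaleC)

lemma clinear_tensor_lift_integrand:
  assumes "\<And>x. cbilinear (f x)" "\<And>v w. clinear (\<lambda>x. f x v w)"
  shows "clinear (\<lambda>x. tensor_lift (f x) u)"
proof (induction u rule: tensor_induct)
  case (tens v w)
  then show ?case using assms(2)[of v w] by (simp add: tensor_lift_tens assms(1))
next
  case (add u v)
  then show ?case
    by (simp add: tensor_lift_add assms(1) clinear_add_fun)
qed

section \<open>Comatrices in a dual-quasitriangular Hopf algebra\<close>

lemma tensor_sum_mult_sum:
  fixes u u' :: "_ \<Rightarrow> 'a::complex_algebra_1" and w w' :: "_ \<Rightarrow> 'b::complex_algebra_1"
  shows "(\<Sum>i\<in>A. u i \<otimes> w i) * (\<Sum>j\<in>B. u' j \<otimes> w' j)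
    = (\<Sum>(i, j)\<in>A \<times> B. (u i * u' j) \<otimes> (w i * w' j))"
  by (simp add: sum_product tens_mult_tens sum.cartesian_product)

text \<open>A Kronecker product whose entries are multiplied in this fixed order; for comodule
  coefficients it is the coefficient matrix of the tensor product comodule.\<close>

definition matrix_tensor :: "('m \<Rightarrow> 'm \<Rightarrow> 'a::times) \<Rightarrow> ('n \<Rightarrow> 'n \<Rightarrow> 'a) \<Rightarrow> 'm \<times> 'n \<Rightarrow> 'm \<times> 'n \<Rightarrow> 'a"
  where "matrix_tensor u w = (\<lambda>(i, k) (j, l). u i j * w k l)"

section \<open>Comatrices and the antipode\<close>

context hopf_algebra
begin

text \<open>The coefficient matrix of a finite-dimensional comodule with a chosen basis. On its
  entries a Sweedler sum becomes a finite sum over an intermediate index.\<close>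

definition comatrix :: "('n::finite \<Rightarrow> 'n \<Rightarrow> 'h) \<Rightarrow> bool"
  where "comatrix u \<longleftrightarrow> (\<forall>i j. \<Delta> (u i j) = (\<Sum>k\<in>UNIV. u i k \<otimes> u k j) \<and> \<epsilon> (u i j) = of_bool (i = j))"

lemma coproduct_linear: "clinear \<Delta>"
  and coproduct_mult: "\<Delta> (x * y) = \<Delta> x * \<Delta> y"
  using coproduct_alg_hom by (auto simp: alg_hom_def)

lemma counit_linear: "clinear \<epsilon>"
  and counit_mult: "\<epsilon> (x * y) = \<epsilon> x * \<epsilon> y"
  using counit_alg_hom by (auto simp: alg_hom_def)

lemma tensor_lift_comatrix:
  assumes "comatrix u" "cbilinear f"
  shows "tensor_lift f (\<Delta> (u i j)) = (\<Sum>k\<in>UNIV. f (u i k) (u k j))"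
  using assms by (simp add: comatrix_def tensor_lift_sum)

lemma comatrix_matrix_tensor:
  assumes "comatrix u" "comatrix w"
  shows "comatrix (matrix_tensor u w)"
  using assms unfolding comatrix_def matrix_tensor_def
  by (auto simp: coproduct_mult counit_mult tensor_sum_mult_sum split_beta intro!: sum.cong)

text \<open>The antipode axioms read entrywise: applying \<open>S\<close> to all entries gives a
  two-sided inverse of \<open>u\<close> over H.\<close>

lemma comatrix_antipode:
  assumes "comatrix u"
  shows "(\<Sum>k\<in>UNIV. S (u i k) * u k j) = of_bool (i = j)"
    and "(\<Sum>k\<in>UNIV. u i k * S (u k j)) = of_bool (i = j)"
proof -
  have "cbilinear (\<lambda>x y. S x * y)" "cbilinear (\<lambda>x y. x * S y)"
    by (rule cbilinear_clinear_comp[OF cbilinear_mult] antipode_linear clinear_id)+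
  from tensor_lift_comatrix[OF assms this(1)] tensor_lift_comatrix[OF assms this(2)]
  show "(\<Sum>k\<in>UNIV. S (u i k) * u k j) = of_bool (i = j)"
    and "(\<Sum>k\<in>UNIV. u i k * S (u k j)) = of_bool (i = j)"
    using assms antipode_left[of "u i j"] antipode_right[of "u i j"]
    by (auto simp: comatrix_def scaleC_one split: if_splits)
qed

text \<open>Left and right inverses of a matrix over H agree.\<close>

lemma antipode_comatrix_unique:
  fixes u w :: "'n::finite \<Rightarrow> 'n \<Rightarrow> 'h"
  assumes "comatrix u" and w: "\<And>i j. (\<Sum>k\<in>UNIV. u i k * w k j) = of_bool (i = j)"
  shows "S (u i j) = w i j"
proof -
  have "S (u i j) = (\<Sum>k\<in>UNIV. S (u i k) * (\<Sum>l\<in>UNIV. u k l * w l j))"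
    by (simp add: w of_bool_def if_distrib[where f = "\<lambda>x. _ * x"] cong: if_cong)
  also have "\<dots> = (\<Sum>l\<in>UNIV. (\<Sum>k\<in>UNIV. S (u i k) * u k l) * w l j)"
    unfolding sum_distrib_left sum_distrib_right mult.assoc by (rule sum.swap)
  also have "\<dots> = w i j"
    by (simp add: comatrix_antipode assms of_bool_def if_distrib[where f = "\<lambda>x. x * _"] cong: if_cong)
  finally show ?thesis .
qed

text \<open>Antimultiplicativity of \<open>S\<close> is derived from the antipode axioms: the
  products on the right form a right inverse of \<open>matrix_tensor u w\<close>, and such an
  inverse is unique.\<close>

lemma antipode_mult_comatrix:
  fixes u :: "'m::finite \<Rightarrow> 'm \<Rightarrow> 'h" and w :: "'n::finite \<Rightarrow> 'n \<Rightarrow> 'h"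
  assumes u: "comatrix u" and w: "comatrix w"
  shows "S (u i j * w k l) = S (w k l) * S (u i j)"
proof -
  have "(\<Sum>m\<in>UNIV. matrix_tensor u w ik m * (case m of (i, k) \<Rightarrow> case jl of (j, l) \<Rightarrow> S (w k l) * S (u i j)))
     = of_bool (ik = jl)" for ik jl
  proof (cases ik; cases jl)
    fix i k j l assume [simp]: "ik = (i, k)" "jl = (j, l)"
    have "(\<Sum>m\<in>UNIV. matrix_tensor u w ik m * (case m of (i, k) \<Rightarrow> case jl of (j, l) \<Rightarrow> S (w k l) * S (u i j)))
       = (\<Sum>m\<in>UNIV. \<Sum>n\<in>UNIV. u i m * w k n * (S (w n l) * S (u m j)))"
      by (simp add: matrix_tensor_def split_beta sum.cartesian_product flip: UNIV_Times_UNIV)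
    \<comment> \<open>The reversed order of the antipodes lets the inner sum over \<open>n\<close>
      collapse first; the sum over \<open>m\<close> then collapses in the same way.\<close>
    also have "\<dots> = (\<Sum>m\<in>UNIV. u i m * (\<Sum>n\<in>UNIV. w k n * S (w n l)) * S (u m j))"
      by (simp add: sum_distrib_left sum_distrib_right mult.assoc)
    also have "\<dots> = of_bool (ik = jl)"
      by (auto simp: comatrix_antipode u w)
    finally show ?thesis .
  qed
  from antipode_comatrix_unique[OF comatrix_matrix_tensor[OF u w] this, of "(i, k)" "(j, l)"]
  show ?thesis by (simp add: matrix_tensor_def)
qed

end

section \<open>The form R, the map Q and the Killing form on comatrices\<close>

context dual_quasitriangular_hopf_algebra
begin

lemma cbilinear_R_mult:
  "cbilinear (\<lambda>x y. R (x \<otimes> z) * R (y \<otimes> w))" "cbilinear (\<lambda>x y. R (z \<otimes> x) * R (w \<otimes> y))"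
  "cbilinear (\<lambda>x y. R (x \<otimes> z) * R (w \<otimes> y))" "cbilinear (\<lambda>x y. R (z \<otimes> x) * R (y \<otimes> w))"
  by (rule cbilinear_clinear_comp[OF cbilinear_mult] clinear_tens_left clinear_tens_right R_linear)+

lemma R_comatrix_mult_left:
  "comatrix w \<Longrightarrow> R ((x * y) \<otimes> w i j) = (\<Sum>k\<in>UNIV. R (x \<otimes> w i k) * R (y \<otimes> w k j))"
  by (simp add: R_mult_left tensor_lift_comatrix cbilinear_R_mult)

text \<open>\<open>R\<close> reverses products in its second argument, so \<open>z\<close> meets the
  first leg of the coproduct.\<close>

lemma R_comatrix_mult_right:
  "comatrix u \<Longrightarrow> R (u i j \<otimes> (y * z)) = (\<Sum>k\<in>UNIV. R (u i k \<otimes> z) * R (u k j \<otimes> y))"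
  by (simp add: R_mult_right tensor_lift_comatrix cbilinear_R_mult)

text \<open>The right side is the R-matrix times its flip, the double braiding of the two
  comodules.\<close>

lemma Q_map_comatrix:
  assumes "comatrix u" "comatrix w"
  shows "Q_map \<Delta> R (w k l) (u i j)
    = (\<Sum>m\<in>UNIV. \<Sum>n\<in>UNIV. R (u i m \<otimes> w k n) * R (w n l \<otimes> u m j))"
proof -
  have bil: "cbilinear (\<lambda>x y. tensor_lift (\<lambda>x' y'. R (x \<otimes> x') * R (y' \<otimes> y)) (\<Delta> h))" for h
    by (rule cbilinear_tensor_lift) (rule cbilinear_R_mult)+
  show ?thesis
    unfolding Q_map_def tensor_lift_comatrix[OF assms(1) bil]
    by (simp only: tensor_lift_comatrix[OF assms(2) cbilinear_R_mult(4)])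
qed

lemma clinear_Q_map: "clinear (\<lambda>h. Q_map \<Delta> R h g)"
proof -
  have 1: "cbilinear (\<lambda>x y. tensor_lift (\<lambda>x' y'. R (x \<otimes> x') * R (y' \<otimes> y)) u)" for u
    by (rule cbilinear_tensor_lift) (rule cbilinear_R_mult)+
  have "clinear (\<lambda>u. tensor_lift (\<lambda>x y. tensor_lift (\<lambda>x' y'. R (x \<otimes> x') * R (y' \<otimes> y)) u) (\<Delta> g))"
    by (rule clinear_tensor_lift_integrand[OF 1]) (rule clinear_tensor_lift[OF cbilinear_R_mult(4)])
  from clinear_comp[OF this coproduct_linear] show ?thesis by (simp only: Q_map_def)
qed

lemma clinear_rho_Q: "clinear (rho_Q \<Delta> R \<rho>)"
  by (rule clinearI)
    (simp_all add: rho_Q_def vec_eq_iff scaleC_vec_def clinear_add[OF clinear_Q_map] clinear_scaleC[OF clinear_Q_map])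

lemma cbilinear_killing_T_integrand: "cbilinear (\<lambda>x x'. R (y \<otimes> S x) *\<^sub>C x')"
  by (rule cbilinear_clinear_comp[OF cbilinear_scaleC
        clinear_comp[OF clinear_tens_right[OF R_linear] antipode_linear] clinear_id])

text \<open>The iterated coproduct of \<open>u i i\<close> has legs \<open>u i k\<close>,
  \<open>u k j\<close>, \<open>u j i\<close>; \<open>R\<close> consumes the first two and leaves the
  third.\<close>

lemma killing_T_comatrix:
  assumes u: "comatrix u" and tau: "killing_tau S \<rho> = (\<Sum>i\<in>UNIV. u i i)"
  shows "killing_T \<Delta> S R \<rho>
    = (\<Sum>i\<in>UNIV. \<Sum>j\<in>UNIV. (\<Sum>k\<in>UNIV. R (u i k \<otimes> S (u k j))) *\<^sub>C u j i)"
proof -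
  \<comment> \<open>Bilinearity comes first, since it is what allows \<open>tensor_lift\<close> to
    be evaluated termwise. In \<open>x'\<close> it rests on linearity of the coproduct, in
    \<open>x\<close> on linearity of \<open>R\<close>.\<close>
  have 1: "cbilinear (\<lambda>x x'. tensor_lift (\<lambda>y y'. R (x \<otimes> S y) *\<^sub>C y') (\<Delta> x'))"
  proof -
    have "clinear (\<lambda>x'. tensor_lift (\<lambda>y y'. R (x \<otimes> S y) *\<^sub>C y') (\<Delta> x'))" for x
      by (rule clinear_comp[OF clinear_tensor_lift[OF cbilinear_killing_T_integrand] coproduct_linear])
    moreover have "clinear (\<lambda>x. R (x \<otimes> S v) *\<^sub>C w)" for v w
      by (intro clinearI) (simp_all add: tens_add_left tens_scaleC_left clinear_add[OF R_linear]
          clinear_scaleC[OF R_linear] scaleC_add_left scaleC_complex_def scaleC_scaleC)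
    then have "clinear (\<lambda>x. tensor_lift (\<lambda>y y'. R (x \<otimes> S y) *\<^sub>C y') (\<Delta> x'))" for x'
      by (rule clinear_tensor_lift_integrand[OF cbilinear_killing_T_integrand])
    ultimately show ?thesis
      unfolding cbilinear_def by blast
  qed
  have "killing_T \<Delta> S R \<rho> = (\<Sum>i\<in>UNIV. tensor_lift (\<lambda>x x'. tensor_lift (\<lambda>y y'. R (x \<otimes> S y) *\<^sub>C y') (\<Delta> x')) (\<Delta> (u i i)))"
    by (simp only: killing_T_def tau clinear_sum[OF coproduct_linear] clinear_sum[OF clinear_tensor_lift[OF 1]])
  also have "\<dots> = (\<Sum>i\<in>UNIV. \<Sum>k\<in>UNIV. \<Sum>j\<in>UNIV. R (u i k \<otimes> S (u k j)) *\<^sub>C u j i)"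
    by (simp only: tensor_lift_comatrix[OF u 1] tensor_lift_comatrix[OF u cbilinear_killing_T_integrand])
  also have "\<dots> = (\<Sum>i\<in>UNIV. \<Sum>j\<in>UNIV. (\<Sum>k\<in>UNIV. R (u i k \<otimes> S (u k j))) *\<^sub>C u j i)"
    unfolding complex_vector.scale_sum_left by (intro sum.cong refl sum.swap)
  finally show ?thesis .
qed

lemma braided_killing_form_comatrix:
  fixes u :: "'n::finite \<Rightarrow> 'n \<Rightarrow> 'h" and \<rho> :: "'m::finite \<Rightarrow> 'm \<Rightarrow> 'h"
  assumes u: "comatrix u" and tau: "killing_tau S \<rho> = (\<Sum>i\<in>UNIV. u i i)"
  defines "N \<equiv> \<lambda>i j. rho_Q \<Delta> R \<rho> (u i j) - of_bool (i = j) *\<^sub>C mat 1"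
  shows "braided_killing_form \<Delta> \<epsilon> S R \<rho>
    = (\<Sum>i\<in>UNIV. \<Sum>j\<in>UNIV. (\<Sum>k\<in>UNIV. R (u i k \<otimes> S (u k j))) *\<^sub>C (\<Sum>k\<in>UNIV. N j k \<otimes> N k i))"
proof -
  define \<rho>Q where "\<rho>Q = rho_Q \<Delta> R \<rho>"
  \<comment> \<open>The four terms of the form, as a function of \<open>T\<close>. This function is
    linear, so its values on the entries of \<open>u\<close> determine it on
    \<open>T\<close>.\<close>
  define F where "F T = tensor_map \<rho>Q \<rho>Q (\<Delta> T) - mat 1 \<otimes> \<rho>Q T - \<rho>Q T \<otimes> mat 1 + \<epsilon> T *\<^sub>C (mat 1 \<otimes> mat 1)" for T
  have lin: "clinear \<rho>Q" unfolding \<rho>Q_def by (rule clinear_rho_Q)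
  have bil: "cbilinear (\<lambda>x y. \<rho>Q x \<otimes> \<rho>Q y)"
    by (rule cbilinear_clinear_comp[OF cbilinear_tens lin lin])
  have "clinear F"
    by (rule clinearI)
     (simp_all add: F_def tensor_map_def clinear_add[OF coproduct_linear] clinear_scaleC[OF coproduct_linear]
      clinear_add[OF lin] clinear_scaleC[OF lin] clinear_add[OF counit_linear] clinear_scaleC[OF counit_linear]
      tensor_lift_add[OF bil] tensor_lift_scaleC[OF bil] tens_add_left tens_add_right tens_scaleC_left tens_scaleC_right
      scaleC_add_left scaleC_add_right complex_vector.scale_right_diff_distrib scaleC_complex_def scaleC_scaleC algebra_simps)
  have F: "F (u j i) = (\<Sum>k\<in>UNIV. N j k \<otimes> N k i)" for i j
  proof -
    \<comment> \<open>Expanding the product gives one summand for each term of \<open>F\<close>; on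
      summing over \<open>k\<close>, the Kronecker deltas contract the last three to single
      terms.\<close>
    have "N j k \<otimes> N k i = \<rho>Q (u j k) \<otimes> \<rho>Q (u k i) - of_bool (j = k) *\<^sub>C (mat 1 \<otimes> \<rho>Q (u k i))
        - of_bool (k = i) *\<^sub>C (\<rho>Q (u j k) \<otimes> mat 1) + (of_bool (j = k) * of_bool (k = i)) *\<^sub>C (mat 1 \<otimes> mat 1)" for k
    proof -
      have d: "(x - y) \<otimes> z = x \<otimes> z - y \<otimes> z" "z \<otimes> (x - y) = z \<otimes> x - z \<otimes> y" for x y z :: "complex^'m^'m"
        using clinear_diff[OF clinear_tens_left[OF clinear_id]] clinear_diff[OF clinear_tens_right[OF clinear_id]]
        by metis+
      show ?thesis
        unfolding N_def \<rho>Q_def[symmetric]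
        by (simp add: d tens_scaleC_left tens_scaleC_right scaleC_scaleC complex_vector.scale_right_diff_distrib)
    qed
    moreover have "\<epsilon> (u j i) = of_bool (j = i)" using u by (simp add: comatrix_def)
    ultimately show ?thesis
      by (simp add: F_def tensor_map_def tensor_lift_comatrix[OF u bil] sum.distrib sum_subtractf of_bool_def
        if_distrib[where f="\<lambda>c. c *\<^sub>C _"] if_distrib[where f = "\<lambda>x. _ * x"] if_distrib[where f = "\<lambda>x. x * _"] scaleC_one cong: if_cong)
  qed
  have "braided_killing_form \<Delta> \<epsilon> S R \<rho> = F (killing_T \<Delta> S R \<rho>)"
    by (simp add: braided_killing_form_def F_def \<rho>Q_def Let_def)
  then show ?thesis
    by (simp add: killing_T_comatrix[OF u tau] clinear_sum[OF \<open>clinear F\<close>] clinear_scaleC[OF \<open>clinear F\<close>] F)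
qed

end

section \<open>Tensor products of matrices of size two\<close>

lemma UNIV_2_Times: "UNIV = {(1, 1), (1, 2), (2, 1), (2, 2::2) :: 2 \<times> 2}"
  by (auto simp: UNIV_2 simp flip: UNIV_Times_UNIV)

lemma sum_2_Times: "sum f (UNIV :: (2 \<times> 2) set) = f (1, 1) + f (1, 2) + f (2, 1) + f (2, 2)"
  by (simp add: UNIV_2_Times add.assoc)

lemma matrix_unit_expansion: "X = (\<Sum>i\<in>UNIV. \<Sum>j\<in>UNIV. X $ i $ j *\<^sub>C matrix_unit i j)"
  by (simp add: vec_eq_iff forall_2 sum_2 scaleC_vec_def matrix_unit_def scaleC_complex_def)

text \<open>The coordinate functionals dual to the tensor products of matrix units.\<close>

definition tensor_entry :: "2 \<Rightarrow> 2 \<Rightarrow> 2 \<Rightarrow> 2 \<Rightarrow> (complex ^ 2 ^ 2, complex ^ 2 ^ 2) tensor \<Rightarrow> complex"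
  where "tensor_entry i j k l = tensor_lift (\<lambda>X Y. X $ i $ j * Y $ k $ l)"

lemma cbilinear_entry: "cbilinear (\<lambda>X Y :: complex ^ 2 ^ 2. X $ i $ j * Y $ k $ l)"
  by (rule cbilinearI) (simp_all add: algebra_simps scaleC_vec_def scaleC_complex_def)

lemma tensor_entry_tens: "tensor_entry i j k l (X \<otimes> Y) = X $ i $ j * Y $ k $ l"
  by (simp add: tensor_entry_def tensor_lift_tens cbilinear_entry)

lemma clinear_tensor_entry: "clinear (tensor_entry i j k l)"
  unfolding tensor_entry_def by (rule clinear_tensor_lift[OF cbilinear_entry])

lemma tensor_entry_add: "tensor_entry i j k l (z + w) = tensor_entry i j k l z + tensor_entry i j k l w"
  by (rule clinear_add[OF clinear_tensor_entry])

lemma tensor_entry_diff: "tensor_entry i j k l (z - w) = tensor_entry i j k l z - tensor_entry i j k l w"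
  by (rule clinear_diff[OF clinear_tensor_entry])

lemma tensor_entry_scaleC: "tensor_entry i j k l (c *\<^sub>C z) = c * tensor_entry i j k l z"
  using clinear_scaleC[OF clinear_tensor_entry] by (simp add: scaleC_complex_def)

lemma tensor_entry_zero: "tensor_entry i j k l 0 = 0"
  by (rule clinear_zero[OF clinear_tensor_entry])

text \<open>Tensors are equivalence classes, so equality has to be tested by coordinates. Expanding
  both factors settles pure tensors, additivity the rest.\<close>

lemma tensor_entry_expansion:
  "z = (\<Sum>i\<in>UNIV. \<Sum>j\<in>UNIV. \<Sum>k\<in>UNIV. \<Sum>l\<in>UNIV.
    tensor_entry i j k l z *\<^sub>C (matrix_unit i j \<otimes> matrix_unit k l))"
proof (induction z rule: tensor_induct)
  case (tens X Y)
  have "X \<otimes> Y = (\<Sum>i\<in>UNIV. \<Sum>j\<in>UNIV. X $ i $ j *\<^sub>C matrix_unit i j)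
      \<otimes> (\<Sum>k\<in>UNIV. \<Sum>l\<in>UNIV. Y $ k $ l *\<^sub>C matrix_unit k l)"
    by (simp only: matrix_unit_expansion[symmetric])
  also have "\<dots> = (\<Sum>i\<in>UNIV. \<Sum>j\<in>UNIV. \<Sum>k\<in>UNIV. \<Sum>l\<in>UNIV.
    (X $ i $ j * Y $ k $ l) *\<^sub>C (matrix_unit i j \<otimes> matrix_unit k l))"
    by (simp add: sum_2 tens_add_left tens_add_right tens_scaleC_left tens_scaleC_right scaleC_scaleC
        scaleC_add_right mult.commute add_ac)
  finally show ?case unfolding tensor_entry_tens .
next
  case (add u v)
  show ?case
    by (subst add(1), subst add(2)) (simp add: tensor_entry_add scaleC_add_left sum.distrib)
qed

lemma tensor_eqI:
  assumes "\<And>i j k l. tensor_entry i j k l z = tensor_entry i j k l w"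
  shows "z = w"
  by (subst tensor_entry_expansion[of z], subst tensor_entry_expansion[of w]) (simp add: assms)

section \<open>Spin one half\<close>

context quantum_SU2
begin

lemma r_nonzero: "r \<noteq> 0" and q_eq: "q = r\<^sup>2"
  using q_nonzero sqrt_q by auto

lemma comatrix_t: "comatrix t"
  by (auto simp: comatrix_def coproduct_t counit_t)

lemma comatrix_tt: "comatrix (matrix_tensor t t)"
  by (intro comatrix_matrix_tensor comatrix_t)

lemma killing_tau_t: "killing_tau S t = (\<Sum>i\<in>UNIV. matrix_tensor t t i i)"
  by (simp add: killing_tau_def sum_2 sum_2_Times matrix_tensor_def antipode_t clinear_add[OF antipode_linear] algebra_simps)

section \<open>The form R on products of generators\<close>

lemma R_t_t_t: "R (t i j \<otimes> (t k l * t m n))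
    = (\<Sum>p\<in>UNIV. R_matrix q r i p m n * R_matrix q r p j k l)"
  by (simp add: R_comatrix_mult_right[OF comatrix_t] R_t)

lemma R_tt_t: "R ((t i j * t k l) \<otimes> t m n)
    = (\<Sum>p\<in>UNIV. R_matrix q r i j m p * R_matrix q r k l p n)"
  by (simp add: R_comatrix_mult_left[OF comatrix_t] R_t)

text \<open>Only the first argument is split, along the comatrix \<open>matrix_tensor t t\<close>;
  the resulting factors are of the kind evaluated by \<open>R_t_t_t\<close>.\<close>

lemma R_tt_tt: "R ((t i j * t k l) \<otimes> (t m n * t m' n'))
    = (\<Sum>p\<in>UNIV. \<Sum>p'\<in>UNIV. R (t i j \<otimes> (t m p * t m' p')) * R (t k l \<otimes> (t p n * t p' n')))"
  using R_comatrix_mult_left[OF comatrix_tt, of "t i j" "t k l" "(m, m')" "(n, n')"]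
  by (simp add: matrix_tensor_def sum_2 sum_2_Times)

lemma R_antipode_tt:
  "R (x \<otimes> S (t k l * t m n)) = R (x \<otimes> (S (t m n) * S (t k l)))"
  by (simp add: antipode_mult_comatrix comatrix_t)

text \<open>Writing entries in \<open>r\<close> turns half-integral powers of \<open>q\<close> into
  integral powers of \<open>r\<close>.\<close>

lemma R_matrix_values:
  "R_matrix q r 1 1 1 1 = r" "R_matrix q r 2 2 2 2 = r"
  "R_matrix q r 1 1 2 2 = 1 / r" "R_matrix q r 2 2 1 1 = 1 / r"
  "R_matrix q r 1 2 2 1 = r - 1 / r ^ 3"
  "R_matrix q r 1 2 1 1 = 0" "R_matrix q r 1 2 1 2 = 0" "R_matrix q r 1 2 2 2 = 0"
  "R_matrix q r 2 1 k l = 0" "R_matrix q r 1 1 1 2 = 0" "R_matrix q r 1 1 2 1 = 0"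
  "R_matrix q r 2 2 1 2 = 0" "R_matrix q r 2 2 2 1 = 0"
  using r_nonzero by (auto simp: R_matrix_def q_eq field_simps eval_nat_numeral)

lemma R_scaleC_right: "R (x \<otimes> (c *\<^sub>C y)) = c * R (x \<otimes> y)"
  by (simp add: tens_scaleC_right clinear_scaleC[OF R_linear] scaleC_complex_def)

lemma R_minus_right: "R (x \<otimes> (- y)) = - R (x \<otimes> y)"
  using R_scaleC_right[of x "-1" y] by (simp add: scaleC_one)

text \<open>The numbers v: the coefficient in T of the entry with indices \<open>j\<close>,
  \<open>i\<close>, in this swapped order.\<close>

definition R_antipode_conv :: "2 \<times> 2 \<Rightarrow> 2 \<times> 2 \<Rightarrow> complex"
  where "R_antipode_conv i j = (\<Sum>k\<in>UNIV. R (matrix_tensor t t i k \<otimes> S (matrix_tensor t t k j)))"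

text \<open>Each summand involves four R-matrix entries, all odd in \<open>r\<close>, so the values
  are rational in \<open>q\<close>. The one block mixing distinct indices is that of (1, 2) and (2,
  1).\<close>

lemma R_antipode_conv_values:
  "R_antipode_conv (1, 1) (1, 1) = 1 / q ^ 6"
  "R_antipode_conv (1, 1) (1, 2) = 0"
  "R_antipode_conv (1, 1) (2, 1) = 0"
  "R_antipode_conv (1, 1) (2, 2) = 0"
  "R_antipode_conv (1, 2) (1, 1) = 0"
  "R_antipode_conv (1, 2) (1, 2) = 1 - 1 / q ^ 2 + 1 / q ^ 4"
  "R_antipode_conv (1, 2) (2, 1) = 1 / q ^ 3 - 1 / q"
  "R_antipode_conv (1, 2) (2, 2) = 0"
  "R_antipode_conv (2, 1) (1, 1) = 0"
  "R_antipode_conv (2, 1) (1, 2) = 1 / q ^ 3 - 1 / q"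
  "R_antipode_conv (2, 1) (2, 1) = 1 / q ^ 2"
  "R_antipode_conv (2, 1) (2, 2) = 0"
  "R_antipode_conv (2, 2) (1, 1) = 0"
  "R_antipode_conv (2, 2) (1, 2) = 0"
  "R_antipode_conv (2, 2) (2, 1) = 0"
  "R_antipode_conv (2, 2) (2, 2) = 1 / q ^ 2"
  using r_nonzero
  by (simp_all add: R_antipode_conv_def sum_2_Times matrix_tensor_def R_antipode_tt antipode_t mult_scaleC_left mult_scaleC_right
      R_scaleC_right R_minus_right R_tt_tt sum_2 R_t_t_t R_matrix_values)
    \<comment> \<open>With \<open>q\<close> replaced by the square of \<open>r\<close>, what remains
      are rational identities in \<open>r\<close>.\<close>
    (simp_all add: q_eq field_simps eval_nat_numeral)

text \<open>The matrices N for the comatrix of generator products.\<close>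

definition rho_Q_reduced :: "2 \<times> 2 \<Rightarrow> 2 \<times> 2 \<Rightarrow> complex ^ 2 ^ 2"
  where "rho_Q_reduced i j = rho_Q \<Delta> R t (matrix_tensor t t i j) - of_bool (i = j) *\<^sub>C mat 1"

lemma Q_map_tt:
  "Q_map \<Delta> R (t k l * t m n) (t i j) = (\<Sum>p\<in>UNIV. \<Sum>u\<in>UNIV. \<Sum>w\<in>UNIV.
      R (t i p \<otimes> (t k u * t m w)) * R ((t u l * t w n) \<otimes> t p j))"
  using Q_map_comatrix[OF comatrix_t comatrix_tt, of "(k, m)" "(l, n)" i j]
  by (simp add: matrix_tensor_def sum_2 sum_2_Times add_ac)

text \<open>Again four R-matrix entries enter each summand. The two zeros reflect weight: passing
  between (1, 1) and (2, 2) shifts it by two steps, a matrix on W by at most one.\<close>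

lemma rho_Q_reduced_values:
  "rho_Q_reduced (1, 1) (1, 1) = (q ^ 2 - 1) *\<^sub>C e_a + (-1 + 1 / q ^ 2) *\<^sub>C e_d"
  "rho_Q_reduced (1, 1) (1, 2) = (1 / q - 1 / q ^ 3) *\<^sub>C e_b"
  "rho_Q_reduced (1, 1) (2, 1) = (1 - 1 / q ^ 2) *\<^sub>C e_b"
  "rho_Q_reduced (1, 1) (2, 2) = 0"
  "rho_Q_reduced (1, 2) (1, 1) = (1 / q - 1 / q ^ 3) *\<^sub>C e_c"
  "rho_Q_reduced (1, 2) (1, 2) = (1 - 2 / q ^ 2 + 1 / q ^ 4) *\<^sub>C e_a"
  "rho_Q_reduced (1, 2) (2, 1) = (q - 2 / q + 1 / q ^ 3) *\<^sub>C e_a"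
  "rho_Q_reduced (1, 2) (2, 2) = (1 - 1 / q ^ 2) *\<^sub>C e_b"
  "rho_Q_reduced (2, 1) (1, 1) = (1 - 1 / q ^ 2) *\<^sub>C e_c"
  "rho_Q_reduced (2, 1) (1, 2) = (q - 2 / q + 1 / q ^ 3) *\<^sub>C e_a"
  "rho_Q_reduced (2, 1) (2, 1) = (q ^ 2 - 2 + 1 / q ^ 2) *\<^sub>C e_a"
  "rho_Q_reduced (2, 1) (2, 2) = (q - 1 / q) *\<^sub>C e_b"
  "rho_Q_reduced (2, 2) (1, 1) = 0"
  "rho_Q_reduced (2, 2) (1, 2) = (1 - 1 / q ^ 2) *\<^sub>C e_c"
  "rho_Q_reduced (2, 2) (2, 1) = (q - 1 / q) *\<^sub>C e_c"
  "rho_Q_reduced (2, 2) (2, 2) = (q ^ 2 - 2 + 1 / q ^ 4) *\<^sub>C e_a + (q ^ 2 - 1) *\<^sub>C e_d"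
  using r_nonzero
  by (simp_all add: rho_Q_reduced_def matrix_tensor_def rho_Q_def vec_eq_iff forall_2 scaleC_vec_def scaleC_complex_def
      e_a_def e_b_def e_c_def e_d_def matrix_unit_def mat_def
      Q_map_tt sum_2 R_t_t_t R_tt_t R_matrix_values)
    (simp_all add: q_eq field_simps eval_nat_numeral)

lemma braided_killing_form_eq:
  "braided_killing_form \<Delta> \<epsilon> S R t
    = (\<Sum>i\<in>UNIV. \<Sum>j\<in>UNIV. R_antipode_conv i j *\<^sub>C (\<Sum>k\<in>UNIV. rho_Q_reduced j k \<otimes> rho_Q_reduced k i))"
  unfolding R_antipode_conv_def rho_Q_reduced_def by (rule braided_killing_form_comatrix[OF comatrix_tt killing_tau_t])

end

theorem proposition4p8:
  fixes q r :: complex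
    and t :: "2 \<Rightarrow> 2 \<Rightarrow> 'h::complex_algebra_1"
    and \<Delta> :: "'h \<Rightarrow> ('h, 'h) tensor"
    and \<epsilon> :: "'h \<Rightarrow> complex"
    and S :: "'h \<Rightarrow> 'h"
    and R :: "('h, 'h) tensor \<Rightarrow> complex"
  assumes "quantum_SU2 \<Delta> \<epsilon> S R q r t"
  shows "inverse ((q - 1)\<^sup>2) *\<^sub>C braided_killing_form \<Delta> \<epsilon> S R t =
    (q powi (-12) * [8]\<^bsub>q\<^esub> * [2]\<^bsub>q\<^esub>) *\<^sub>C eta_K q
    - ((1 - q powi (-2)) * ([3]\<^bsub>q\<^esub> * (q powi (-9) + q powi (-7)) - ([2]\<^bsub>q\<^esub>)\<^sup>2 * q powi (-2)))
        *\<^sub>C (theta \<otimes> theta)"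
proof -
  interpret quantum_SU2 \<Delta> \<epsilon> S R q r t by (rule assms)
  \<comment> \<open>Genericity at exponents 1 and 2 makes the denominators of the q-numbers and of
    1/[2] nonzero.\<close>
  have q: "q \<noteq> 0" "q - 1 \<noteq> 0" "1 + q \<noteq> 0"
  proof -
    show "q \<noteq> 0" by (rule q_nonzero)
    show "q - 1 \<noteq> 0" using q_generic[of 1] by simp
    show "1 + q \<noteq> 0"
    proof
      assume "1 + q = 0"
      then have "q = - 1" by (simp add: eq_neg_iff_add_eq_0 add.commute)
      then show False using q_generic[of 2] by simp
    qed
  qed
  have br: "[2]\<^bsub>q\<^esub> = 1 + q" "[3]\<^bsub>q\<^esub> = 1 + q + q ^ 2"
     "[8]\<^bsub>q\<^esub> = 1 + q + q ^ 2 + q ^ 3 + q ^ 4 + q ^ 5 + q ^ 6 + q ^ 7"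
    unfolding q_number_def using q(2) by (simp_all add: field_simps eval_nat_numeral)
  define A where "A = q powi (-12) * [8]\<^bsub>q\<^esub> * [2]\<^bsub>q\<^esub>"
  define B where "B = (1 - q powi (-2)) * ([3]\<^bsub>q\<^esub> * (q powi (-9) + q powi (-7)) - ([2]\<^bsub>q\<^esub>)\<^sup>2 * q powi (-2))"
  have A: "A = (1 + q + q ^ 2 + q ^ 3 + q ^ 4 + q ^ 5 + q ^ 6 + q ^ 7) * (1 + q) / q ^ 12"
    unfolding A_def br by (simp add: power_int_minus divide_inverse)
  \<comment> \<open>The factor [2] of \<open>A\<close> cancels the 1/[2] inside
    \<open>eta_K\<close>, so that only powers of \<open>q\<close> remain as denominators.\<close>
  then have C: "A * (inverse (1 + q) * x) = (1 + q + q ^ 2 + q ^ 3 + q ^ 4 + q ^ 5 + q ^ 6 + q ^ 7) / q ^ 12 * x"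
     "A * inverse (1 + q) = (1 + q + q ^ 2 + q ^ 3 + q ^ 4 + q ^ 5 + q ^ 6 + q ^ 7) / q ^ 12" for x
    using q(3) by (simp_all add: divide_inverse)
  have B: "B = (1 - 1 / q ^ 2) * ((1 + q + q ^ 2) * (1 / q ^ 9 + 1 / q ^ 7) - (1 + q) ^ 2 / q ^ 2)"
    unfolding B_def br by (simp add: power_int_minus divide_inverse)
  have K: "braided_killing_form \<Delta> \<epsilon> S R t = (q - 1)\<^sup>2 *\<^sub>C (A *\<^sub>C eta_K q - B *\<^sub>C (theta \<otimes> theta))"
  proof (rule tensor_eqI)
    fix i j k l :: 2
    \<comment> \<open>Quantifying over the indices lets \<open>forall_2\<close> split the claim into
      16 scalar identities. \<open>A\<close> and \<open>B\<close> stay opaque until the entries are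
      computed.\<close>
    have "\<forall>i j k l. tensor_entry i j k l (braided_killing_form \<Delta> \<epsilon> S R t) =
      tensor_entry i j k l ((q - 1)\<^sup>2 *\<^sub>C (A *\<^sub>C eta_K q - B *\<^sub>C (theta \<otimes> theta)))"
      unfolding forall_2 braided_killing_form_eq sum_2_Times R_antipode_conv_values rho_Q_reduced_values eta_K_def br
      by (simp add: tensor_entry_add tensor_entry_diff
        tensor_entry_scaleC tensor_entry_tens tensor_entry_zero  theta_def
        e_a_def e_b_def e_c_def e_d_def matrix_unit_def scaleC_vec_def scaleC_complex_def C)
       \<comment> \<open>Clearing powers of \<open>q\<close> leaves polynomial identities.\<close>
       (intro conjI; simp add: A B q(1) field_simps; simp add: eval_nat_numeral algebra_simps)
    then show "tensor_entry i j k l (braided_killing_form \<Delta> \<epsilon> S R t) =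
      tensor_entry i j k l ((q - 1)\<^sup>2 *\<^sub>C (A *\<^sub>C eta_K q - B *\<^sub>C (theta \<otimes> theta)))" by blast
  qed
  show ?thesis
    unfolding K A_def[symmetric] B_def[symmetric] using q(2) by (simp add: scaleC_scaleC scaleC_one)
qed

end
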